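(* Consider a sequence of clique detection problems indexed by $N\to\infty$ with clique size $n=n_N$ and background connection probability $p_0=p_{0,N}$ (and $p_1=1$), satisfying the standing assumptions of the context. If $$\binom{N}{n}\, p_0^{\frac{n(n-1)}{2}} \to \infty ,$$ then all tests are asymptotically powerless, i.e. $\inf_T \gamma_N(T)\to 1$, where the infimum is over all tests $T$ (equivalently, $\liminf_N \gamma_N(T_N)\ge 1$ for every sequence of tests $(T_N)$).
   Context: Observed data: the adjacency matrix $\boldsymbol{W}=(W_{i,j})\in\{0,1\}^{N\times N}$ (symmetric, zero diagonal) of a random undirected graph on the node set $\{1,\dots,N\}$. Under $\mathbb{P}_0$ (null), the $W_{i,j}$, $i<j$, are i.i.d. Bernoulli$(p_0)$ with $p_0\in(0,1)$. For $S\subset\{1,\dots,N\}$ with $|S|=n$, under $\mathbb{P}_S$ (alternative), the $W_{i,j}$, $i<j$, are independent, $W_{i,j}=1$ almost surely if $i,j\in S$ (so $S$ is a clique), and $\mathbb{P}_S(W_{i,j}=1)=p_0$ otherwise. A test $T$ is a function of $\boldsymbol{W}$ with values in $\{0,1\}$, and its risk is $\gamma_N(T)=\mathbb{P}_0(T=1)+\max_{|S|=n}\mathbb{P}_S(T=0)$. Standing assumptions: $N\to\infty$; $n$ and $p_0$ may depend on $N$ ($n$ need not tend to infinity); $n/N\to 0$; $p_0$ is bounded away from $1$; $N^2p_0\to\infty$. *)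

theory Defs
  imports "HOL-Probability.Probability"
begin

definition vertex_pairs :: "nat \<Rightarrow> (nat \<times> nat) set" where
  "vertex_pairs N = {(i, j). 1 \<le> i \<and> i < j \<and> j \<le> N}"

text \<open>Matrices in \<open>{0,1}\<^bsup>N\<times>N\<^esup>\<close> are represented as functions on indices that vanish outside
  \<open>{1..N} \<times> {1..N}\<close>; the vanishing comes from the default value \<open>False\<close> of \<^const>\<open>Pi_pmf\<close> below.\<close>

type_synonym adjacency = "nat \<Rightarrow> nat \<Rightarrow> nat"

definition adjacency_matrix :: "(nat \<times> nat \<Rightarrow> bool) \<Rightarrow> adjacency" where
  "adjacency_matrix e = (\<lambda>i j. of_bool (i \<noteq> j \<and> e (min i j, max i j)))"

definition graph_law :: "nat \<Rightarrow> (nat \<times> nat \<Rightarrow> real) \<Rightarrow> adjacency pmf" where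
  "graph_law N q =
     map_pmf adjacency_matrix (Pi_pmf (vertex_pairs N) False (\<lambda>e. bernoulli_pmf (q e)))"

definition null_law :: "nat \<Rightarrow> real \<Rightarrow> adjacency pmf" where
  "null_law N p = graph_law N (\<lambda>_. p)"

definition clique_law :: "nat \<Rightarrow> real \<Rightarrow> nat set \<Rightarrow> adjacency pmf" where
  "clique_law N p S = graph_law N (\<lambda>(i, j). if i \<in> S \<and> j \<in> S then 1 else p)"

definition tests :: "(adjacency \<Rightarrow> nat) set" where
  "tests = {T. \<forall>W. T W \<in> {0, 1}}"

text \<open>The maximum is over a nonempty set only when \<open>n \<le> N\<close>.\<close>

definition risk :: "nat \<Rightarrow> nat \<Rightarrow> real \<Rightarrow> (adjacency \<Rightarrow> nat) \<Rightarrow> real" where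
  "risk N n p T =
     measure_pmf.prob (null_law N p) {W. T W = 1} +
     Max ((\<lambda>S. measure_pmf.prob (clique_law N p S) {W. T W = 0}) ` {S. S \<subseteq> {1..N} \<and> card S = n})"

end

theory Submission
  imports Defs "HOL-Real_Asymp.Real_Asymp"
begin

text \<open>
  Second moment method. Averaging over the clique position bounds the risk below by
  \<open>1 - sqrt (E[L\<^sup>2] - 1)\<close>, where \<open>L\<close> is the mean over \<open>S\<close> of the likelihood ratios and
  \<open>E[L\<^sup>2]\<close> is the mean over pairs \<open>(S, T)\<close> of \<open>p\<close> to the power \<open>- (|S \<inter> T| choose 2)\<close>. A union bound
  over the subsets of \<open>S \<inter> T\<close> gives \<open>E[L\<^sup>2] - 1 \<le> \<Sum>k=1..n. b k\<close> with
  \<open>b k = (n choose k)\<^sup>2 / \<mu> k\<close>, where \<open>\<mu> k\<close> is the expected number of \<open>k\<close>-cliques under the null.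
  Put \<open>q = n\<^sup>3 / root 4 N\<close>. If \<open>p ^ (k - 1)\<close> is at least \<open>N powr (-3/2)\<close> then \<open>b k \<le> q ^ k\<close>; otherwise
  passing from \<open>k\<close>-cliques to \<open>n\<close>-cliques loses so much that \<open>b k \<le> q ^ (n - k) / \<mu> n\<close>.
  Finally \<open>\<mu> n \<ge> 1\<close> and \<open>p \<le> c < 1\<close> force \<open>n = O(ln N)\<close>, so \<open>q\<close> tends to 0, and the sum is at most
  \<open>2 q + 2 / \<mu> n\<close>.
\<close>

section \<open>Risk and the second moment of the averaged likelihood ratio\<close>

text \<open>Meant for \<open>F\<close> the acceptance region and \<open>C i\<close> the presence of
  the \<open>i\<close>-th clique, so that the indicator of \<open>C i\<close> over \<open>r\<close>
  is a likelihood ratio and \<open>L\<close> their mean. The left side is 1 plus the expectation of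
  \<open>(L - 1)\<close> on \<open>F\<close>. Since \<open>L\<close> has mean 1, that expectation is
  at most the standard deviation of \<open>L\<close> in absolute value.\<close>

lemma average_likelihood_ratio_bound:
  fixes M :: "'a pmf" and C :: "'i \<Rightarrow> 'a set" and r :: real
  assumes fin: "finite (set_pmf M)" and I: "finite I" "I \<noteq> {}" and r: "r > 0"
    and prob_C: "\<And>i. i \<in> I \<Longrightarrow> measure_pmf.prob M (C i) = r"
  shows "measure_pmf.prob M (- F) + (\<Sum>i\<in>I. measure_pmf.prob M (F \<inter> C i) / r) / card I \<ge>
    1 - sqrt ((\<Sum>i\<in>I. \<Sum>j\<in>I. measure_pmf.prob M (C i \<inter> C j) / r\<^sup>2) / (real (card I))\<^sup>2 - 1)"
proof -
  define c where "c = real (card I)"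
  have c: "c > 0" using I by (simp add: c_def card_gt_0_iff)
  have int [simp]: "integrable M f" for f :: "'a \<Rightarrow> real"
    using fin by (rule integrable_measure_pmf_finite)
  define L where "L x = (\<Sum>i\<in>I. indicator (C i) x / r) / c" for x
  define Y where "Y x = (L x - 1) * indicator F x" for x
  have EL: "measure_pmf.expectation M L = 1"
    using c r by (simp add: L_def[abs_def] prob_C flip: c_def)
  have "L x ^ 2 = (\<Sum>i\<in>I. \<Sum>j\<in>I. indicator (C i \<inter> C j) x / r\<^sup>2) / c\<^sup>2" for x
    by (simp add: L_def power_divide power2_eq_square sum_product indicator_inter_arith)
  hence EL2: "measure_pmf.expectation M (\<lambda>x. L x ^ 2) =
      (\<Sum>i\<in>I. \<Sum>j\<in>I. measure_pmf.prob M (C i \<inter> C j) / r\<^sup>2) / c\<^sup>2"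
    by simp
  have "measure_pmf.expectation M Y = measure_pmf.expectation M
      (\<lambda>x. (\<Sum>i\<in>I. indicator (F \<inter> C i) x / r) / c - indicator F x)"
    by (rule arg_cong[where f = "measure_pmf.expectation M"])
       (auto simp: Y_def L_def indicator_def fun_eq_iff)
  also have "\<dots> = (\<Sum>i\<in>I. measure_pmf.prob M (F \<inter> C i) / r) / c - measure_pmf.prob M F"
    by simp
  finally have EY: "measure_pmf.expectation M Y =
    (\<Sum>i\<in>I. measure_pmf.prob M (F \<inter> C i) / r) / c - measure_pmf.prob M F" .
  \<comment> \<open>Nonnegativity of the variance of \<open>Y\<close>; the indicator of
    \<open>F\<close> is then dropped, which makes the bound uniform in \<open>F\<close>.\<close>
  have "(measure_pmf.expectation M Y)\<^sup>2 \<le> measure_pmf.expectation M (\<lambda>x. (Y x)\<^sup>2)"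
    using measure_pmf.variance_positive[of M Y] measure_pmf.variance_eq[of M Y] by simp
  also have "\<dots> \<le> measure_pmf.expectation M (\<lambda>x. (L x - 1)\<^sup>2)"
    by (intro integral_mono) (auto simp: Y_def indicator_def)
  also have "\<dots> = measure_pmf.expectation M (\<lambda>x. (L x)\<^sup>2) - 1"
    by (simp add: power2_diff EL)
  finally have "\<bar>measure_pmf.expectation M Y\<bar> \<le> sqrt (measure_pmf.expectation M (\<lambda>x. (L x)\<^sup>2) - 1)"
    using real_sqrt_le_mono by fastforce
  moreover have "measure_pmf.prob M (- F) = 1 - measure_pmf.prob M F"
    using measure_pmf.prob_compl[of F M] by (simp add: Compl_eq_Diff_UNIV)
  ultimately show ?thesis
    unfolding EY EL2 c_def by linarith
qed

section \<open>Edge configurations and likelihood ratios of cliques\<close>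

definition clique_pairs :: "nat set \<Rightarrow> (nat \<times> nat) set" where
  "clique_pairs S = {(i, j). i \<in> S \<and> j \<in> S \<and> i < j}"

lemma finite_clique_pairs [simp]: "finite S \<Longrightarrow> finite (clique_pairs S)"
  by (rule finite_subset[of _ "S \<times> S"]) (auto simp: clique_pairs_def)

lemma card_clique_pairs:
  assumes "finite S"
  shows "card (clique_pairs S) = card S choose 2"
proof -
  have inj: "inj_on (\<lambda>(i, j). {i, j}) (clique_pairs S)"
    by (auto simp: inj_on_def clique_pairs_def doubleton_eq_iff)
  have "(\<lambda>(i, j). {i, j}) ` clique_pairs S = {B. B \<subseteq> S \<and> card B = 2}"
  proof safe
    fix B assume B: "B \<subseteq> S" "card B = 2"
    then obtain i j where "B = {i, j}" "i \<noteq> j" by (auto simp: card_2_iff)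
    with B have "B = (case (min i j, max i j) of (i, j) \<Rightarrow> {i, j})"
      "(min i j, max i j) \<in> clique_pairs S"
      by (auto simp: clique_pairs_def min_def max_def)
    thus "B \<in> (\<lambda>(i, j). {i, j}) ` clique_pairs S" by blast
  qed (auto simp: clique_pairs_def)
  thus ?thesis
    using card_image[OF inj] n_subsets[OF assms, of 2] by simp
qed

lemma vertex_pairs_eq: "vertex_pairs N = clique_pairs {1..N}"
  by (auto simp: vertex_pairs_def clique_pairs_def)

text \<open>The null model before \<open>adjacency_matrix\<close> is applied: likelihood ratios are
  computed on independent edge indicators.\<close>

definition graph_config :: "nat \<Rightarrow> real \<Rightarrow> (nat \<times> nat \<Rightarrow> bool) pmf" where
  "graph_config N p = Pi_pmf (vertex_pairs N) False (\<lambda>_. bernoulli_pmf p)"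

lemma finite_set_graph_config: "finite (set_pmf (graph_config N p))"
  unfolding graph_config_def
  by (rule finite_subset[OF set_Pi_pmf_subset'])
     (auto simp: vertex_pairs_eq intro!: finite_PiE_dflt)

lemma prob_all_edges:
  assumes "B \<subseteq> vertex_pairs N" "0 \<le> p" "p \<le> 1"
  shows "measure_pmf.prob (graph_config N p) {e. \<forall>x\<in>B. e x} = p ^ card B"
proof -
  have fin: "finite (vertex_pairs N)" by (simp add: vertex_pairs_eq)
  \<comment> \<open>Written as a product event over all vertex pairs, with no constraint off
    \<open>B\<close>, so that independence applies.\<close>
  have "{e. \<forall>x\<in>B. e x} = Pi (vertex_pairs N) (\<lambda>x. if x \<in> B then {True} else UNIV)"
    using assms(1) by (auto simp: Pi_def)
  hence "measure_pmf.prob (graph_config N p) {e. \<forall>x\<in>B. e x} =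
     (\<Prod>x\<in>vertex_pairs N. measure_pmf.prob (bernoulli_pmf p) (if x \<in> B then {True} else UNIV))"
    by (simp add: graph_config_def measure_Pi_pmf_Pi fin)
  also have "\<dots> = (\<Prod>x\<in>vertex_pairs N. if x \<in> B then p else 1)"
    using assms by (intro prod.cong) (auto simp: measure_pmf_single)
  also have "\<dots> = p ^ card B"
    using fin assms(1) by (simp add: prod.If_cases Int_absorb1)
  finally show ?thesis .
qed

text \<open>Because clique edges are present almost surely, the alternative is the null law
  conditioned on the clique on \<open>S\<close>. The two mass functions are compared edge by
  edge.\<close>

lemma prob_clique_law:
  assumes S: "S \<subseteq> {1..N}" and p: "0 < p" "p < 1"
  shows "measure_pmf.prob (clique_law N p S) E =
    measure_pmf.prob (graph_config N p) (adjacency_matrix -` E \<inter> {e. \<forall>x\<in>clique_pairs S. e x})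
      / p ^ card (clique_pairs S)"
proof -
  let ?V = "vertex_pairs N" and ?K = "clique_pairs S"
  let ?C = "{e. \<forall>x\<in>?K. e x}" and ?r = "p ^ card ?K"
  let ?q = "\<lambda>(i, j). if i \<in> S \<and> j \<in> S then 1 else p"
  let ?Q = "Pi_pmf ?V False (\<lambda>e. bernoulli_pmf (?q e))"
  have fin: "finite ?V" by (simp add: vertex_pairs_eq)
  have KV: "?K \<subseteq> ?V" using S by (auto simp: clique_pairs_def vertex_pairs_def)
  have q: "?q x = (if x \<in> ?K then 1 else p)" if "x \<in> ?V" for x
    using that by (auto simp: clique_pairs_def vertex_pairs_def split: prod.splits)
  have pmf_eq: "pmf ?Q e = indicator ?C e * pmf (graph_config N p) e / ?r" for e
  proof (cases "\<forall>x. x \<notin> ?V \<longrightarrow> e x = False")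
    case True
    have "pmf ?Q e = (\<Prod>x\<in>?V. pmf (bernoulli_pmf (if x \<in> ?K then 1 else p)) (e x))"
      using True by (simp add: pmf_Pi fin q cong: prod.cong)
    \<comment> \<open>For a clique edge that is present, both sides equal 1 because \<open>p\<close>
      cancels; for an absent one, both vanish.\<close>
    also have "\<dots> = (\<Prod>x\<in>?V. (if x \<in> ?K \<longrightarrow> e x then 1 else 0) * pmf (bernoulli_pmf p) (e x)
         / (if x \<in> ?K then p else 1))"
      using p by (intro prod.cong) auto
    also have "\<dots> = (\<Prod>x\<in>?V. if x \<in> ?K \<longrightarrow> e x then 1 else 0) * pmf (graph_config N p) e
         / (\<Prod>x\<in>?V. if x \<in> ?K then p else 1)"
      using True by (simp add: prod_dividef prod.distrib pmf_Pi fin graph_config_def)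
    also have "(\<Prod>x\<in>?V. if x \<in> ?K then p else 1) = ?r"
      using fin KV by (simp add: prod.If_cases Int_absorb1)
    also have "(\<Prod>x\<in>?V. if x \<in> ?K \<longrightarrow> e x then 1 else (0::real)) = indicator ?C e"
      using fin KV by (auto simp: indicator_def intro!: prod.neutral)
    finally show ?thesis .
  next
    \<comment> \<open>A configuration that leaves the default \<open>False\<close> outside the
      vertex pairs has mass 0 under both laws.\<close>
    case False
    thus ?thesis by (auto simp: pmf_Pi fin graph_config_def)
  qed
  let ?D = "set_pmf (graph_config N p)"
  have D: "finite ?D" by (rule finite_set_graph_config)
  \<comment> \<open>Absolute continuity: both probabilities become sums over the same finite
    support.\<close>
  have QD: "set_pmf ?Q \<subseteq> ?D"
    by (auto simp: set_pmf_eq pmf_eq)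
  let ?F = "adjacency_matrix -` E"
  have "measure_pmf.prob (clique_law N p S) E = measure_pmf.prob ?Q ?F"
    by (simp add: clique_law_def graph_law_def)
  also have "\<dots> = measure_pmf.expectation ?Q (indicator ?F)" by simp
  also have "\<dots> = (\<Sum>e\<in>?D. indicator ?F e * pmf ?Q e)"
    using QD by (intro integral_measure_pmf_real D) auto
  also have "\<dots> = (\<Sum>e\<in>?D. indicator (?F \<inter> ?C) e * pmf (graph_config N p) e) / ?r"
    by (simp add: pmf_eq sum_divide_distrib indicator_inter_arith mult_ac)
  also have "(\<Sum>e\<in>?D. indicator (?F \<inter> ?C) e * pmf (graph_config N p) e) =
      measure_pmf.expectation (graph_config N p) (indicator (?F \<inter> ?C))"
    by (intro integral_measure_pmf_real[symmetric] D) auto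
  finally show ?thesis by simp
qed

text \<open>Inclusion-exclusion: two cliques share exactly the edges inside
  \<open>S \<inter> T\<close>, and only these are counted twice in the square of the
  denominator.\<close>

lemma clique_overlap_prob:
  assumes S: "S \<subseteq> {1..N}" "T \<subseteq> {1..N}" "card S = n" "card T = n" and p: "0 < p" "p < 1"
  shows "measure_pmf.prob (graph_config N p)
      ({e. \<forall>x\<in>clique_pairs S. e x} \<inter> {e. \<forall>x\<in>clique_pairs T. e x}) / (p ^ (n choose 2))\<^sup>2
    = 1 / p ^ (card (S \<inter> T) choose 2)"
proof -
  have f: "finite S" "finite T" using S by (auto intro: finite_subset)
  have "{e. \<forall>x\<in>clique_pairs S. e x} \<inter> {e. \<forall>x\<in>clique_pairs T. e x} =
      {e. \<forall>x\<in>clique_pairs S \<union> clique_pairs T. e x}" for e :: "nat \<times> nat \<Rightarrow> bool"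
    by auto
  moreover have "clique_pairs S \<union> clique_pairs T \<subseteq> vertex_pairs N"
    using S by (auto simp: clique_pairs_def vertex_pairs_def)
  ultimately have "measure_pmf.prob (graph_config N p)
      ({e. \<forall>x\<in>clique_pairs S. e x} \<inter> {e. \<forall>x\<in>clique_pairs T. e x}) =
      p ^ card (clique_pairs S \<union> clique_pairs T)"
    using p by (simp add: prob_all_edges)
  moreover have "clique_pairs S \<inter> clique_pairs T = clique_pairs (S \<inter> T)"
    by (auto simp: clique_pairs_def)
  hence "card (clique_pairs S \<union> clique_pairs T) + (card (S \<inter> T) choose 2) = 2 * (n choose 2)"
    using card_Un_Int[of "clique_pairs S" "clique_pairs T"] f S by (simp add: card_clique_pairs)
  hence "p ^ card (clique_pairs S \<union> clique_pairs T) * p ^ (card (S \<inter> T) choose 2) =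
      (p ^ (n choose 2))\<^sup>2"
    by (simp flip: power_add power_mult add: mult.commute)
  ultimately show ?thesis using p by (simp add: field_simps)
qed

section \<open>The second moment as a sum over overlap sizes\<close>

lemma card_supersets:
  assumes "finite A" "K \<subseteq> A" "card K \<le> n"
  shows "card {S. K \<subseteq> S \<and> S \<subseteq> A \<and> card S = n} = (card A - card K) choose (n - card K)"
proof -
  have fK: "finite K" using assms finite_subset by blast
  have "bij_betw (\<lambda>S. S - K) {S. K \<subseteq> S \<and> S \<subseteq> A \<and> card S = n} {B. B \<subseteq> A - K \<and> card B = n - card K}"
  proof (rule bij_betw_byWitness[where f' = "\<lambda>B. B \<union> K"])
    show "(\<lambda>B. B \<union> K) ` {B. B \<subseteq> A - K \<and> card B = n - card K}
        \<subseteq> {S. K \<subseteq> S \<and> S \<subseteq> A \<and> card S = n}"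
    proof safe
      fix B assume "B \<subseteq> A - K" "card B = n - card K"
      moreover from this have "finite B" "B \<inter> K = {}" using assms by (auto intro: finite_subset)
      ultimately show "card (B \<union> K) = n" using fK assms by (simp add: card_Un_disjoint)
    qed (use assms in auto)
  qed (use fK in \<open>auto simp: card_Diff_subset\<close>)
  thus ?thesis
    using n_subsets[of "A - K" "n - card K"] assms fK
    by (simp add: bij_betw_same_card card_Diff_subset)
qed

text \<open>This is \<open>b k\<close> of the introduction, with \<open>\<mu> k\<close> as the
  denominator.\<close>

definition overlap_term :: "nat \<Rightarrow> nat \<Rightarrow> real \<Rightarrow> nat \<Rightarrow> real" where
  "overlap_term N n p k = (real (n choose k))\<^sup>2 / (real (N choose k) * p ^ (k choose 2))"

text \<open>The exact distribution of the overlap size is avoided: each summand is bounded by 1 plus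
  a sum over all nonempty \<open>K\<close> contained in \<open>S \<inter> T\<close>. After
  exchanging the sums, only the number of \<open>T\<close> containing a given \<open>K\<close> is
  needed.\<close>

lemma sum_overlap_le:
  fixes p :: real
  assumes S: "S \<subseteq> {1..N}" "card S = n" and p: "0 < p"
  shows "(\<Sum>T | T \<subseteq> {1..N} \<and> card T = n. 1 / p ^ (card (S \<inter> T) choose 2)) \<le>
    real (N choose n) * (1 + (\<Sum>k=1..n. overlap_term N n p k))"
proof -
  let ?I = "{T. T \<subseteq> {1..N} \<and> card T = n}"
  let ?P = "Pow S - {{}}" and ?g = "\<lambda>k. 1 / p ^ (k choose 2)"
  have fS: "finite S" using S by (auto intro: finite_subset)
  have nN: "n \<le> N" using S card_mono[of "{1..N}" S] by simp
  have fI: "finite ?I" by simp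
  have cI: "card ?I = N choose n" using n_subsets[of "{1..N}" n] by simp
  have "(\<Sum>T\<in>?I. ?g (card (S \<inter> T))) \<le> (\<Sum>T\<in>?I. 1 + (\<Sum>K\<in>?P. if K \<subseteq> T then ?g (card K) else 0))"
  proof (rule sum_mono)
    fix T assume "T \<in> ?I"
    show "?g (card (S \<inter> T)) \<le> 1 + (\<Sum>K\<in>?P. if K \<subseteq> T then ?g (card K) else 0)"
    proof (cases "S \<inter> T = {}")
      case True
      have "0 \<le> (\<Sum>K\<in>?P. if K \<subseteq> T then ?g (card K) else 0)"
        using p by (intro sum_nonneg) auto
      with True show ?thesis by (simp add: numeral_2_eq_2)
    next
      case False
      \<comment> \<open>The single term \<open>K = S \<inter> T\<close> already suffices; the
        summand 1 serves the case of disjoint sets.\<close>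
      have "(if S \<inter> T \<subseteq> T then ?g (card (S \<inter> T)) else 0) \<le> (\<Sum>K\<in>?P. if K \<subseteq> T then ?g (card K) else 0)"
        using p fS False by (intro member_le_sum) auto
      thus ?thesis by simp
    qed
  qed
  also have "\<dots> = real (N choose n) + (\<Sum>K\<in>?P. \<Sum>T\<in>?I. if K \<subseteq> T then ?g (card K) else 0)"
    using cI by (simp add: sum.distrib, subst sum.swap) simp
  also have "(\<Sum>K\<in>?P. \<Sum>T\<in>?I. if K \<subseteq> T then ?g (card K) else 0) =
      (\<Sum>K\<in>?P. real ((N - card K) choose (n - card K)) * ?g (card K))"
  proof (rule sum.cong[OF refl])
    fix K assume K: "K \<in> ?P"
    hence "K \<subseteq> {1..N}" "card K \<le> n" using S fS by (auto intro: card_mono)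
    moreover have "?I \<inter> {T. K \<subseteq> T} = {T. K \<subseteq> T \<and> T \<subseteq> {1..N} \<and> card T = n}" by auto
    ultimately show "(\<Sum>T\<in>?I. if K \<subseteq> T then ?g (card K) else 0) =
        real ((N - card K) choose (n - card K)) * ?g (card K)"
      using card_supersets[of "{1..N}" K n] by (simp add: sum.If_cases fI)
  qed
  also have "\<dots> = (\<Sum>k=1..n. \<Sum>K | K \<in> ?P \<and> card K = k. real ((N - card K) choose (n - card K)) * ?g (card K))"
  proof (rule sum.group[symmetric])
    show "card ` ?P \<subseteq> {1..n}"
      using fS S card_mono[OF fS] by (auto simp: Suc_le_eq card_gt_0_iff finite_subset)
  qed (use fS in auto)
  also have "\<dots> = (\<Sum>k=1..n. real (N choose n) * overlap_term N n p k)"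
  proof (rule sum.cong[OF refl])
    fix k assume k: "k \<in> {1..n}"
    have "{K. K \<in> ?P \<and> card K = k} = {K. K \<subseteq> S \<and> card K = k}" using k by auto
    hence "card {K. K \<in> ?P \<and> card K = k} = n choose k"
      using n_subsets[OF fS, of k] S by simp
    hence "(\<Sum>K | K \<in> ?P \<and> card K = k. real ((N - card K) choose (n - card K)) * ?g (card K))
        = real (n choose k) * (real ((N - k) choose (n - k)) * ?g k)"
      by simp
    \<comment> \<open>Double counting of pairs of nested sets trades the superset count for a second
      factor \<open>n choose k\<close>, whence the square in \<open>overlap_term\<close>.\<close>
    also have "real (N choose n) * real (n choose k) = real (N choose k) * real ((N - k) choose (n - k))"
      using choose_mult[of k n N] k nN by (simp flip: of_nat_mult)
    hence "real ((N - k) choose (n - k)) = real (N choose n) * real (n choose k) / real (N choose k)"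
      using k nN by (simp add: field_simps)
    finally show "(\<Sum>K | K \<in> ?P \<and> card K = k. real ((N - card K) choose (n - card K)) * ?g (card K))
        = real (N choose n) * overlap_term N n p k"
      by (simp add: overlap_term_def power2_eq_square field_simps)
  qed
  finally show ?thesis by (simp add: algebra_simps sum_distrib_left)
qed


section \<open>Bounds on the overlap terms\<close>

text \<open>The threshold \<open>1 / s ^ 6\<close> gives \<open>p ^ (k choose 2)\<close> at least
  \<open>(1 / s ^ 3) ^ k\<close>. Together with \<open>N choose k\<close> at least
  \<open>(N / n) ^ k\<close>, each of the \<open>k\<close> factors is at most
  \<open>n ^ 2 * (n / N) * s ^ 3\<close>, which is \<open>n ^ 3 / s\<close> as
  \<open>N = s ^ 4\<close>.\<close>

lemma overlap_term_le_small:
  fixes p s :: real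
  assumes k: "1 \<le> k" "k \<le> n" "n \<le> N" and p: "0 < p" and s: "s > 0" "s ^ 4 = real N"
    and large: "1 / s ^ 6 \<le> p ^ (k - 1)"
  shows "overlap_term N n p k \<le> (real n ^ 3 / s) ^ k"
proof -
  \<comment> \<open>Squares are compared because \<open>k choose 2\<close> is half of
    \<open>k * (k - 1)\<close>.\<close>
  have "((1 / s ^ 3) ^ k)\<^sup>2 = (1 / s ^ 6) ^ k"
    by (simp add: power_divide flip: power_mult)
  also have "\<dots> \<le> (p ^ (k - 1)) ^ k" using large s by (intro power_mono) auto
  also have "\<dots> = (p ^ (k choose 2))\<^sup>2"
    using k by (simp add: choose_two mult.commute flip: power_mult)
  finally have P: "(1 / s ^ 3) ^ k \<le> p ^ (k choose 2)"
    by (rule power2_le_imp_le) (use p in simp)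
  have "(real N / real n) ^ k \<le> (real N / real k) ^ k"
    using k by (intro power_mono divide_left_mono) auto
  also have "\<dots> \<le> real (N choose k)" using k by (intro binomial_ge_n_over_k_pow_k) simp
  finally have Nk: "(real N / real n) ^ k \<le> real (N choose k)" .
  have "real (n choose k) \<le> real n ^ k" using binomial_le_pow[of k n] k by (simp flip: of_nat_power)
  hence "(real (n choose k))\<^sup>2 \<le> (real n ^ k)\<^sup>2" by (intro power_mono) auto
  hence "overlap_term N n p k \<le> (real n ^ k)\<^sup>2 / ((real N / real n) ^ k * (1 / s ^ 3) ^ k)"
    unfolding overlap_term_def using P Nk k s p by (intro frac_le mult_mono mult_pos_pos) auto
  also have "\<dots> = ((real n)\<^sup>2 / (real N / real n * (1 / s ^ 3))) ^ k"
    by (simp add: power_mult_distrib power_divide power_mult mult.commute flip: power_mult)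
  also have "(real n)\<^sup>2 / (real N / real n * (1 / s ^ 3)) = real n ^ 3 / s"
    using s k by (simp add: field_simps power2_eq_square power3_eq_cube flip: s(2))
      (simp add: power4_eq_xxxx)
  finally show ?thesis .
qed

text \<open>Enlarging a \<open>k\<close>-clique adds at least \<open>k - 1\<close> edges per new
  vertex. This count matches the exponent in the case split on \<open>p ^ (k - 1)\<close>.\<close>

lemma choose_two_diff_ge: "k \<le> n \<Longrightarrow> (k choose 2) + (k - 1) * (n - k) \<le> n choose 2"
proof (induction n rule: dec_induct)
  case (step n)
  have "Suc n choose 2 = (n choose 2) + n" by (simp add: numeral_2_eq_2)
  moreover have "(k - 1) * (Suc n - k) = (k - 1) * (n - k) + (k - 1)"
    using step by (simp add: Suc_diff_le)
  ultimately show ?case using step by linarith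
qed simp

text \<open>Compares \<open>k\<close>-cliques with \<open>n\<close>-cliques. Each of the
  \<open>n - k\<close> further vertices contributes at most \<open>n\<close> from
  \<open>n choose k\<close>, at most \<open>N\<close> from the choice of the vertex, and at most
  \<open>1 / s ^ 6\<close> from its edges.\<close>

lemma overlap_term_le_large:
  fixes p s :: real
  assumes k: "1 \<le> k" "k \<le> n" "n \<le> N" and p: "0 < p" "p < 1" and s: "s \<ge> 1" "s ^ 4 = real N"
    and small: "p ^ (k - 1) \<le> 1 / s ^ 6"
  shows "overlap_term N n p k \<le> (real n ^ 3 / s) ^ (n - k) / (real (N choose n) * p ^ (n choose 2))"
proof -
  define j where "j = n - k"
  have "(k choose 2) + (k - 1) * j \<le> n choose 2"
    using choose_two_diff_ge[of k n] k by (simp add: j_def)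
  hence "p ^ (n choose 2) \<le> p ^ (k choose 2) * (p ^ (k - 1)) ^ j"
    using p by (simp add: power_decreasing flip: power_add power_mult)
  also have "\<dots> \<le> p ^ (k choose 2) * (1 / s ^ 6) ^ j"
    using p small by (intro mult_left_mono power_mono) auto
  finally have P: "p ^ (n choose 2) \<le> p ^ (k choose 2) * (1 / s ^ 6) ^ j" .
  have "n choose k \<le> n ^ j"
    using binomial_le_pow[of j n] k by (simp add: j_def binomial_symmetric[of k n])
  hence nk: "real (n choose k) \<le> real n ^ j" by (simp flip: of_nat_power)
  have "(N - k) choose j \<le> (N - k) ^ j" using k by (intro binomial_le_pow) (simp add: j_def)
  also have "\<dots> \<le> N ^ j" by (intro power_mono) auto
  finally have Nk: "real ((N - k) choose j) \<le> real N ^ j" by (simp flip: of_nat_power)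
  have "real (N choose n) * real (n choose k) = real (N choose k) * real ((N - k) choose j)"
    using choose_mult[of k n N] k by (simp add: j_def flip: of_nat_mult)
  hence "overlap_term N n p k * (real (N choose n) * p ^ (n choose 2)) =
      real (n choose k) * real ((N - k) choose j) * (p ^ (n choose 2) / p ^ (k choose 2))"
    using k p by (simp add: overlap_term_def field_simps power2_eq_square)
  also have "\<dots> \<le> real n ^ j * real N ^ j * (1 / s ^ 6) ^ j"
    using nk Nk P p by (intro mult_mono) (auto simp: field_simps)
  also have "\<dots> = (real n * real N * (1 / s ^ 6)) ^ j" by (simp only: power_mult_distrib)
  also have "real n * real N * (1 / s ^ 6) = real n / s\<^sup>2"
    using s(1) by (simp add: field_simps flip: s(2) power_add)
  \<comment> \<open>A deliberate weakening, so that both cases have the same ratio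
    \<open>n ^ 3 / s\<close>.\<close>
  also have "(real n / s\<^sup>2) ^ j \<le> (real n ^ 3 / s) ^ j"
    using s k self_le_power[of "real n" 3] self_le_power[of s 2] by (intro power_mono frac_le) auto
  finally show ?thesis
    using k p by (simp add: pos_le_divide_eq j_def)
qed

lemma geometric_sum_le_2:
  fixes q :: real
  assumes "0 \<le> q" "q \<le> 1 / 2"
  shows "(\<Sum>k<n. q ^ k) \<le> 2"
proof -
  have "(\<Sum>k<n. q ^ k) = (1 - q ^ n) / (1 - q)" using assms by (simp add: sum_gp_strict)
  also have "\<dots> \<le> 1 / (1 / 2)" using assms by (intro frac_le) auto
  finally show ?thesis by simp
qed

lemma sum_overlap_term_le:
  fixes p s :: real
  assumes n: "n \<le> N" and p: "0 < p" "p < 1" and s: "s \<ge> 1" "s ^ 4 = real N"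
    and q: "real n ^ 3 / s \<le> 1 / 2"
  shows "(\<Sum>k=1..n. overlap_term N n p k) \<le>
    2 * (real n ^ 3 / s) + 2 / (real (N choose n) * p ^ (n choose 2))"
proof -
  define q where "q = real n ^ 3 / s"
  define \<mu> where "\<mu> = real (N choose n) * p ^ (n choose 2)"
  have q0: "0 \<le> q" "q \<le> 1 / 2" using s q by (auto simp: q_def)
  have \<mu>: "\<mu> > 0" using n p by (simp add: \<mu>_def)
  \<comment> \<open>Adding both bounds for every \<open>k\<close> avoids locating where the case
    changes.\<close>
  have "(\<Sum>k=1..n. overlap_term N n p k) \<le> (\<Sum>k=1..n. q ^ k + q ^ (n - k) / \<mu>)"
  proof (rule sum_mono)
    fix k assume k: "k \<in> {1..n}"
    have "overlap_term N n p k \<le> q ^ k \<or> overlap_term N n p k \<le> q ^ (n - k) / \<mu>"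
      using overlap_term_le_small[of k n N p s] overlap_term_le_large[of k n N p s] k n p s
      unfolding q_def \<mu>_def by (cases "1 / s ^ 6 \<le> p ^ (k - 1)") auto
    moreover have "q ^ k \<ge> 0" "q ^ (n - k) / \<mu> \<ge> 0" using q0 \<mu> by auto
    ultimately show "overlap_term N n p k \<le> q ^ k + q ^ (n - k) / \<mu>" by linarith
  qed
  also have "\<dots> = (\<Sum>k=1..n. q ^ k) + (\<Sum>k=1..n. q ^ (n - k)) / \<mu>"
    by (simp add: sum.distrib sum_divide_distrib)
  \<comment> \<open>Here exponents start at 1, so a factor \<open>q\<close> comes out. The second
    sum contains \<open>q ^ 0\<close> from \<open>k = n\<close>, and only the division by
    \<open>\<mu>\<close> makes it small.\<close>
  also have "(\<Sum>k=1..n. q ^ k) = q * (\<Sum>k<n. q ^ k)"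
    by (simp add: sum_distrib_left sum.atLeast1_atMost_eq)
  also have "(\<Sum>k=1..n. q ^ (n - k)) = (\<Sum>k<n. q ^ k)"
    by (rule sum.reindex_bij_witness[of _ "\<lambda>k. n - k" "\<lambda>k. n - k"]) auto
  also have "q * (\<Sum>k<n. q ^ k) + (\<Sum>k<n. q ^ k) / \<mu> \<le> q * 2 + 2 / \<mu>"
    using geometric_sum_le_2[OF q0, of n] q0 \<mu>
    by (intro add_mono mult_left_mono divide_right_mono) auto
  finally show ?thesis by (simp add: q_def \<mu>_def mult.commute)
qed

section \<open>Lower and upper bounds for the risk\<close>

text \<open>The maximal type II error is at least its mean over \<open>S\<close>, which reduces the
  claim to the averaged likelihood ratio.\<close>

lemma risk_ge:
  assumes T: "T \<in> tests" and n: "n \<le> N" and p: "0 < p" "p < 1"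
  shows "risk N n p T \<ge> 1 - sqrt (\<Sum>k=1..n. overlap_term N n p k)"
proof -
  define I where "I = {S. S \<subseteq> {1..N} \<and> card S = n}"
  define C where "C S = {e :: nat \<times> nat \<Rightarrow> bool. \<forall>x\<in>clique_pairs S. e x}" for S
  define F where "F = adjacency_matrix -` {W. T W = 0}"
  define r where "r = p ^ (n choose 2)"
  let ?M = "graph_config N p"
  let ?a = "\<lambda>S. measure_pmf.prob (clique_law N p S) {W. T W = 0}"
  have fI: "finite I" by (simp add: I_def)
  have cI: "card I = N choose n" using n_subsets[of "{1..N}" n] by (simp add: I_def)
  hence cI0: "card I > 0" using n by simp
  hence I0: "I \<noteq> {}" by auto
  have cc: "card (clique_pairs S) = n choose 2" if "S \<in> I" for S
    using that by (auto simp: I_def card_clique_pairs finite_subset)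
  have "{W. T W = 1} = - {W. T W = 0}" using T by (force simp: tests_def)
  hence null: "measure_pmf.prob (null_law N p) {W. T W = 1} = measure_pmf.prob ?M (- F)"
    by (simp add: null_law_def graph_law_def graph_config_def F_def vimage_Compl)
  have alt: "?a S = measure_pmf.prob ?M (F \<inter> C S) / r" if "S \<in> I" for S
    using prob_clique_law[of S N p] cc[OF that] that p by (simp add: I_def F_def C_def r_def)
  have "measure_pmf.prob ?M (C S) = r" if "S \<in> I" for S
    using that p cc[OF that] unfolding C_def r_def
    by (subst prob_all_edges) (auto simp: I_def clique_pairs_def vertex_pairs_def)
  hence lower: "measure_pmf.prob ?M (- F) + (\<Sum>S\<in>I. measure_pmf.prob ?M (F \<inter> C S) / r) / card I \<ge>
    1 - sqrt ((\<Sum>S\<in>I. \<Sum>S'\<in>I. measure_pmf.prob ?M (C S \<inter> C S') / r\<^sup>2) / (real (card I))\<^sup>2 - 1)"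
    using p fI I0 by (intro average_likelihood_ratio_bound finite_set_graph_config) (auto simp: r_def)
  have "(\<Sum>S\<in>I. \<Sum>S'\<in>I. measure_pmf.prob ?M (C S \<inter> C S') / r\<^sup>2)
      = (\<Sum>S\<in>I. \<Sum>S'\<in>I. 1 / p ^ (card (S \<inter> S') choose 2))"
    using p unfolding C_def r_def
    by (intro sum.cong refl clique_overlap_prob) (auto simp: I_def)
  also have "\<dots> \<le> (\<Sum>S\<in>I. real (card I) * (1 + (\<Sum>k=1..n. overlap_term N n p k)))"
    using sum_overlap_le[of _ N n p] p unfolding cI unfolding I_def by (intro sum_mono) auto
  also have "\<dots> = (real (card I))\<^sup>2 * (1 + (\<Sum>k=1..n. overlap_term N n p k))"
    by (simp add: power2_eq_square)
  finally have "(\<Sum>S\<in>I. \<Sum>S'\<in>I. measure_pmf.prob ?M (C S \<inter> C S') / r\<^sup>2) / (real (card I))\<^sup>2 - 1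
      \<le> (\<Sum>k=1..n. overlap_term N n p k)"
    using cI0 by (simp add: diff_le_eq pos_divide_le_eq add.commute mult.commute)
  hence root: "sqrt ((\<Sum>S\<in>I. \<Sum>S'\<in>I. measure_pmf.prob ?M (C S \<inter> C S') / r\<^sup>2) / (real (card I))\<^sup>2 - 1)
      \<le> sqrt (\<Sum>k=1..n. overlap_term N n p k)"
    by (rule real_sqrt_le_mono)
  have "(\<Sum>S\<in>I. measure_pmf.prob ?M (F \<inter> C S) / r) \<le> (\<Sum>S\<in>I. Max (?a ` I))"
    using fI by (intro sum_mono) (auto simp flip: alt)
  hence "(\<Sum>S\<in>I. measure_pmf.prob ?M (F \<inter> C S) / r) / card I \<le> Max (?a ` I)"
    using cI0 by (simp add: divide_simps mult.commute)
  thus ?thesis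
    using lower root unfolding risk_def null I_def[symmetric] by linarith
qed

text \<open>Never rejecting has type I error 0 and type II error 1; this caps the infimum at
  1.\<close>

lemma risk_trivial_test:
  assumes "n \<le> N"
  shows "risk N n p (\<lambda>_. 0) = 1"
proof -
  let ?I = "{S. S \<subseteq> {1..N} \<and> card S = n}"
  have "card ?I > 0" using n_subsets[of "{1..N}" n] assms by simp
  hence "?I \<noteq> {}" by (metis card.empty less_irrefl)
  hence "(\<lambda>S. 1::real) ` ?I = {1}" by blast
  thus ?thesis by (simp add: risk_def)
qed

section \<open>Logarithmic clique size and the limit\<close>

text \<open>Taking logarithms in \<open>1 \<le> N ^ n * c ^ (n choose 2)\<close> and cancelling
  \<open>n\<close> leaves a linear inequality in \<open>n\<close>; hence the separate case
  \<open>n = 0\<close>.\<close>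

lemma clique_size_le:
  fixes p c :: real
  assumes n: "n \<le> N" "N \<ge> 1" and p: "0 < p" "p \<le> c" "c < 1"
    and \<mu>: "1 \<le> real (N choose n) * p ^ (n choose 2)"
  shows "real n \<le> 1 + 2 / ln (1 / c) * ln (real N)"
proof (cases "n = 0")
  case True
  thus ?thesis using p n by simp
next
  case False
  have "real (N choose n) \<le> real N ^ n"
    using binomial_le_pow[OF n(1)] by (simp flip: of_nat_power)
  hence "real (N choose n) * p ^ (n choose 2) \<le> real N ^ n * c ^ (n choose 2)"
    using p by (intro mult_mono power_mono) auto
  with \<mu> have "1 \<le> real N ^ n * c ^ (n choose 2)" by linarith
  hence "ln 1 \<le> ln (real N ^ n * c ^ (n choose 2))" by (subst ln_le_cancel_iff) auto
  also have "\<dots> = real n * ln (real N) + real (n choose 2) * ln c"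
    using n p by (simp add: ln_mult ln_realpow)
  also have "real (n choose 2) = real n * (real n - 1) / 2"
    using False by (simp add: choose_two real_of_nat_div of_nat_diff)
  also have "real n * ln (real N) + real n * (real n - 1) / 2 * ln c =
      real n * (ln (real N) - (real n - 1) / 2 * ln (1 / c))"
    using p by (simp add: ln_div field_simps)
  finally have "0 \<le> real n * (ln (real N) - (real n - 1) / 2 * ln (1 / c))"
    by simp
  hence "(real n - 1) / 2 * ln (1 / c) \<le> ln (real N)"
    using False by (simp add: zero_le_mult_iff)
  moreover have "ln (1 / c) > 0" using p by simp
  ultimately show ?thesis by (simp add: field_simps)
qed

theorem theorem1:
  fixes n :: "nat \<Rightarrow> nat" and p0 :: "nat \<Rightarrow> real"
  assumes "\<And>N. n N \<le> N"
    and "\<And>N. 0 < p0 N \<and> p0 N < 1"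
    and "(\<lambda>N. real (n N) / real N) \<longlonglongrightarrow> 0"
    and "\<exists>c<1. \<forall>N. p0 N \<le> c"
    and "filterlim (\<lambda>N. (real N)\<^sup>2 * p0 N) at_top sequentially"
    and "filterlim (\<lambda>N. real (N choose n N) * p0 N ^ (n N * (n N - 1) div 2)) at_top sequentially"
  shows "(\<lambda>N. INF T\<in>tests. risk N (n N) (p0 N) T) \<longlonglongrightarrow> 1"
proof -
  from assms(4) obtain c where c: "c < 1" "\<And>N. p0 N \<le> c" by blast
  have c0: "c > 0" using assms(2)[of 0] c(2)[of 0] by linarith
  define a where "a = 2 / ln (1 / c)"
  have a: "a > 0" using c c0 by (simp add: a_def)
  define \<mu> where "\<mu> N = real (N choose n N) * p0 N ^ (n N choose 2)" for N
  \<comment> \<open>The fourth root required by the overlap bounds; it is at least 1 only from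
    \<open>N = 1\<close> on.\<close>
  define s where "s N = real N powr (1 / 4)" for N
  define q where "q N = real (n N) ^ 3 / s N" for N
  have \<mu>: "filterlim \<mu> at_top sequentially"
    using assms(6) by (simp add: \<mu>_def[abs_def] choose_two)
  have s: "s N ^ 4 = real N" "s N \<ge> 1" if "N \<ge> 1" for N
    using that by (auto simp: s_def powr_powr ge_one_powr_ge_zero simp flip: powr_numeral)
  have "eventually (\<lambda>N. N \<ge> 1 \<and> \<mu> N \<ge> 1) sequentially"
    using \<mu> by (auto simp: filterlim_at_top intro: eventually_conj eventually_ge_at_top)
  hence q_le: "eventually (\<lambda>N. q N \<le> (1 + a * ln (real N)) ^ 3 / real N powr (1 / 4)) sequentially"
  proof eventually_elim
    case (elim N)
    hence "real (n N) \<le> 1 + a * ln (real N)"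
      unfolding a_def using assms(1,2) c by (intro clique_size_le[of _ _ "p0 N"]) (auto simp: \<mu>_def)
    thus ?case by (auto simp: q_def s_def intro!: divide_right_mono power_mono)
  qed
  \<comment> \<open>A power of the logarithm loses against the fourth root.\<close>
  have "(\<lambda>N. (1 + a * ln (real N)) ^ 3 / real N powr (1 / 4)) \<longlonglongrightarrow> 0"
    using a by real_asymp
  from tendsto_sandwich[OF _ q_le tendsto_const this] have q: "q \<longlonglongrightarrow> 0"
    by (simp add: q_def[abs_def] s_def)
  have lim: "(\<lambda>N. 1 - sqrt (2 * q N + 2 * inverse (\<mu> N))) \<longlonglongrightarrow> 1"
    using tendsto_diff[OF tendsto_const[of 1] tendsto_real_sqrt[OF tendsto_add[OF
      tendsto_mult_left[OF q] tendsto_mult_left[OF tendsto_inverse_0_at_top[OF \<mu>]]]], of 2 2]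
    by simp
  have ge: "1 - sqrt (\<Sum>k=1..n N. overlap_term N (n N) (p0 N) k) \<le> risk N (n N) (p0 N) T"
    if "T \<in> tests" for T N
    using that assms(1,2) by (intro risk_ge) auto
  have zero: "(\<lambda>_. 0) \<in> tests" by (simp add: tests_def)
  \<comment> \<open>The lower bound \<open>ge\<close> does not depend on \<open>T\<close>.
    Boundedness is what gives the real infimum its meaning.\<close>
  have bdd: "bdd_below (risk N (n N) (p0 N) ` tests)" for N
    by (rule bdd_belowI2[where f = "risk N (n N) (p0 N)"]) (rule ge)
  have upper: "(INF T\<in>tests. risk N (n N) (p0 N) T) \<le> 1" for N
    using cINF_lower[OF bdd zero, of N] risk_trivial_test[OF assms(1)] by simp
  have "eventually (\<lambda>N. q N < 1 / 2) sequentially"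
    using q by (rule order_tendstoD) simp
  with eventually_ge_at_top[of "1::nat"]
  have "eventually (\<lambda>N. 1 - sqrt (2 * q N + 2 * inverse (\<mu> N)) \<le>
      (INF T\<in>tests. risk N (n N) (p0 N) T)) sequentially"
  proof eventually_elim
    case (elim N)
    have "(\<Sum>k=1..n N. overlap_term N (n N) (p0 N) k) \<le> 2 * q N + 2 * inverse (\<mu> N)"
      using sum_overlap_term_le[of "n N" N "p0 N" "s N"] elim s[of N] assms(1)[of N] assms(2)[of N]
      unfolding q_def \<mu>_def divide_inverse[of 2, symmetric] by linarith
    hence "sqrt (\<Sum>k=1..n N. overlap_term N (n N) (p0 N) k) \<le> sqrt (2 * q N + 2 * inverse (\<mu> N))"
      by (rule real_sqrt_le_mono)
    hence "1 - sqrt (2 * q N + 2 * inverse (\<mu> N)) \<le> risk N (n N) (p0 N) T" if "T \<in> tests" for T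
      using ge[OF that, of N] by linarith
    moreover have "tests \<noteq> {}" using zero by blast
    ultimately show ?case by (intro cINF_greatest)
  qed
  thus ?thesis
    by (rule tendsto_sandwich[OF _ always_eventually lim tendsto_const]) (use upper in blast)
qed

end
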